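(* For every $\varepsilon>0$, the Median function does not admit a polytime synchronized bit protocol with communication complexity $O\left(\log^{1-\varepsilon} n\right)$.
   Context: Median problem of size $n$: Alice holds a subset $A\subseteq\{1,\dots,n\}$ and Bob holds a subset $B\subseteq\{1,\dots,n\}$; they must determine the median of the multiset union of $A$ and $B$. Synchronized bit model: an extension of the standard two-party deterministic communication model in which the players share a common clock; in each time step a player may send $0$, $1$, or a blank, and blanks do not count towards the communication complexity (only the number of non-blank symbols sent counts). A polytime synchronized bit protocol is one that runs for a number of time steps polynomial in $n$. *)

theory Defs
  imports Complex_Main "HOL-Library.Multiset" "HOL-Library.Landau_Symbols"
begin

text \<open>
  What a player sends in one time step: \<open>None\<close> is a blank. A transcript lists, in chronological
  order, the pair (Alice's symbol, Bob's symbol) of every time step. Both players always know the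
  transcript so far, hence in particular (by its length) the current time.
\<close>

type_synonym symbol = "bool option"
type_synonym transcript = "(symbol \<times> symbol) list"

text \<open>
  The two symbols of a time step are sent simultaneously. A protocol in which
  only one designated player may send in each step is the special case where the other one sends a
  blank.
\<close>

record ('x, 'y, 'z) protocol =
  steps :: nat
  alice_send :: "'x \<Rightarrow> transcript \<Rightarrow> symbol"
  bob_send :: "'y \<Rightarrow> transcript \<Rightarrow> symbol"
  alice_output :: "'x \<Rightarrow> transcript \<Rightarrow> 'z"
  bob_output :: "'y \<Rightarrow> transcript \<Rightarrow> 'z"

fun run_for :: "nat \<Rightarrow> ('x, 'y, 'z) protocol \<Rightarrow> 'x \<Rightarrow> 'y \<Rightarrow> transcript" where
  "run_for 0 P x y = []"
| "run_for (Suc t) P x y =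
     (let h = run_for t P x y in h @ [(alice_send P x h, bob_send P y h)])"

definition run :: "('x, 'y, 'z) protocol \<Rightarrow> 'x \<Rightarrow> 'y \<Rightarrow> transcript" where
  "run P x y = run_for (steps P) P x y"

definition computes_on ::
    "('x, 'y, 'z) protocol \<Rightarrow> ('x \<times> 'y) set \<Rightarrow> ('x \<Rightarrow> 'y \<Rightarrow> 'z) \<Rightarrow> bool" where
  "computes_on P D f \<longleftrightarrow> (\<forall>(x, y) \<in> D.
     alice_output P x (run P x y) = f x y \<and> bob_output P y (run P x y) = f x y)"

definition nonblanks :: "transcript \<Rightarrow> nat" where
  "nonblanks h = length (filter (\<lambda>(a, b). a \<noteq> None) h) + length (filter (\<lambda>(a, b). b \<noteq> None) h)"

text \<open>Worst-case cost; only meaningful for finite nonempty \<open>D\<close>.\<close>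

definition comm_cost :: "('x, 'y, 'z) protocol \<Rightarrow> ('x \<times> 'y) set \<Rightarrow> nat" where
  "comm_cost P D = Max ((\<lambda>(x, y). nonblanks (run P x y)) ` D)"

text \<open>
  A problem is a family of (possibly partial) two-argument functions, \<open>f n\<close> on the
  inputs \<open>D n\<close> of size \<open>n\<close>, and protocols are non-uniform families, one protocol for each size.
  Local computation is unrestricted; ``polytime'' only refers to the number of time steps.
\<close>

definition admits_polytime_protocol ::
    "(nat \<Rightarrow> ('x \<times> 'y) set) \<Rightarrow> (nat \<Rightarrow> 'x \<Rightarrow> 'y \<Rightarrow> 'z) \<Rightarrow> (nat \<Rightarrow> real) \<Rightarrow> bool" where
  "admits_polytime_protocol D f g \<longleftrightarrow>
     (\<exists>P. (\<forall>n. computes_on (P n) (D n) (f n)) \<and>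
          (\<exists>k. (\<lambda>n. real (steps (P n))) \<in> O(\<lambda>n. real n ^ k)) \<and>
          (\<lambda>n. real (comm_cost (P n) (D n))) \<in> O(g))"

text \<open>
  The median of \<open>t > 0\<close> elements is the \<open>\<lceil>t/2\<rceil>\<close>-th smallest one, i.e.\ the lower of the two
  middle elements if \<open>t\<close> is even. The multiset union counts elements of \<open>A \<inter> B\<close> twice.
  The empty multiset has no median, so that \<open>({}, {})\<close> is not an input.
\<close>

definition multiset_median :: "'a::linorder multiset \<Rightarrow> 'a" where
  "multiset_median M = sorted_list_of_multiset M ! ((size M - 1) div 2)"

definition median :: "nat set \<Rightarrow> nat set \<Rightarrow> nat" where
  "median A B = multiset_median (mset_set A + mset_set B)"

definition median_inputs :: "nat \<Rightarrow> (nat set \<times> nat set) set" where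
  "median_inputs n = {(A, B). A \<subseteq> {1..n} \<and> B \<subseteq> {1..n} \<and> A \<union> B \<noteq> {}}"

end

theory Submission
  imports Defs "HOL-Library.FuncSet" "HOL-Real_Asymp.Real_Asymp"
begin

text \<open>
  Median contains pointer jumping on a \<open>b\<close>-ary tree of depth \<open>D\<close> with alternating owners, for
  \<open>n = (5 * b) ^ D\<close>. With \<open>b = D ^ 2\<close> this makes \<open>D\<close> almost as large as \<open>log 2 n\<close>. A non-blank symbol
  in one of \<open>T\<close> time steps conveys only about \<open>log 2 T\<close> bits, and silence conveys \<open>O(1)\<close> bits. So the
  protocol is a sequence of short messages, and round elimination applies: \<open>log 2 T = O(D log D)\<close>
  bits about the \<open>b\<close> subtrees of a node say almost nothing about most of them, whence each message
  advances the protocol by at most three levels of the tree and at least \<open>D / 3\<close> symbols are sent.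
\<close>

section \<open>Transformations of protocols\<close>

text \<open>Counting transcripts is useless here: in polynomially many time steps a bounded number
  of symbols can convey \<open>log 2 n\<close> bits by their timing, enough to name the median. What
  helps is that a message is sent before its sender knows the receiver's next pointer, so that it is
  spread over \<open>b\<close> subtrees. This needs \<open>b\<close> to exceed
  \<open>log 2 T\<close> by a constant factor, where \<open>log 2 T = O(D * log 2 b)\<close>;
  \<open>b = D ^ 2\<close> achieves it for large \<open>D\<close>, whatever the degree of the
  polynomial. The price is a depth of \<open>log 2 n / log 2 (5 * b)\<close>, short of
  \<open>log 2 n\<close> by a factor of order \<open>log log n\<close>, and \<epsilon> absorbs this
  factor. Knowledge is measured by density: between messages, each player's remaining inputs are at
  least a quarter of all inputs on the current subtree.\<close>

lemma nonblanks_append [simp]: "nonblanks (g @ h) = nonblanks g + nonblanks h"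
  by (simp add: nonblanks_def)

lemma nonblanks_map_swap [simp]: "nonblanks (map prod.swap h) = nonblanks h"
  by (induction h) (auto simp: nonblanks_def)

definition residual :: "transcript \<Rightarrow> ('x, 'y, 'z) protocol \<Rightarrow> ('x, 'y, 'z) protocol" where
  "residual h P = \<lparr>steps = steps P - length h,
     alice_send = (\<lambda>x g. alice_send P x (h @ g)), bob_send = (\<lambda>y g. bob_send P y (h @ g)),
     alice_output = (\<lambda>x g. alice_output P x (h @ g)),
     bob_output = (\<lambda>y g. bob_output P y (h @ g))\<rparr>"

definition swap_players :: "('x, 'y, 'z) protocol \<Rightarrow> ('y, 'x, 'z) protocol" where
  "swap_players P = \<lparr>steps = steps P,
     alice_send = (\<lambda>y g. bob_send P y (map prod.swap g)),
     bob_send = (\<lambda>x g. alice_send P x (map prod.swap g)),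
     alice_output = (\<lambda>y g. bob_output P y (map prod.swap g)),
     bob_output = (\<lambda>x g. alice_output P x (map prod.swap g))\<rparr>"

definition transform_protocol ::
    "('a \<Rightarrow> 'x) \<Rightarrow> ('b \<Rightarrow> 'y) \<Rightarrow> ('z \<Rightarrow> 'c) \<Rightarrow> ('x, 'y, 'z) protocol \<Rightarrow> ('a, 'b, 'c) protocol" where
  "transform_protocol \<phi> \<psi> g P = \<lparr>steps = steps P,
     alice_send = (\<lambda>x. alice_send P (\<phi> x)), bob_send = (\<lambda>y. bob_send P (\<psi> y)),
     alice_output = (\<lambda>x h. g (alice_output P (\<phi> x) h)),
     bob_output = (\<lambda>y h. g (bob_output P (\<psi> y) h))\<rparr>"

lemma run_for_residual:
  assumes "run_for (length h) P x y = h"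
  shows "run_for (length h + t) P x y = h @ run_for t (residual h P) x y"
  using assms by (induction t) (auto simp: residual_def Let_def)

lemma run_residual:
  assumes "run_for (length h) P x y = h" "length h \<le> steps P"
  shows "run P x y = h @ run (residual h P) x y"
  using run_for_residual[OF assms(1), of "steps P - length h"] assms(2)
  by (simp add: run_def residual_def)

lemma run_swap_players: "run (swap_players P) y x = map prod.swap (run P x y)"
proof -
  have "run_for t (swap_players P) y x = map prod.swap (run_for t P x y)" for t
    by (induction t) (auto simp: swap_players_def Let_def)
  then show ?thesis
    by (simp add: run_def) (simp add: swap_players_def)
qed

lemma run_transform_protocol: "run (transform_protocol \<phi> \<psi> g P) x y = run P (\<phi> x) (\<psi> y)"
proof -
  have "run_for t (transform_protocol \<phi> \<psi> g P) x y = run_for t P (\<phi> x) (\<psi> y)" for t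
    by (induction t) (auto simp: transform_protocol_def Let_def)
  then show ?thesis
    by (simp add: run_def) (simp add: transform_protocol_def)
qed

lemma computes_on_swap_players:
  assumes "computes_on P (X \<times> Y) f"
  shows "computes_on (swap_players P) (Y \<times> X) (\<lambda>y x. f x y)"
  using assms by (auto simp: computes_on_def run_swap_players) (auto simp: swap_players_def)

text \<open>The pointwise bound on the cost, unlike \<open>comm_cost\<close>, passes to smaller
  rectangles \<open>X \<times> Y\<close> without any finiteness condition. \<open>T\<close> is only
  an upper bound because residual protocols have fewer steps.\<close>

definition solvable :: "nat \<Rightarrow> nat \<Rightarrow> 'x set \<Rightarrow> 'y set \<Rightarrow> ('x \<Rightarrow> 'y \<Rightarrow> 'z) \<Rightarrow> bool" where
  "solvable T c X Y f \<longleftrightarrow> (\<exists>P. steps P \<le> T \<and> computes_on P (X \<times> Y) f \<and>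
     (\<forall>x\<in>X. \<forall>y\<in>Y. nonblanks (run P x y) \<le> c))"

lemma solvable_mono: "solvable T c X Y f \<Longrightarrow> T \<le> T' \<Longrightarrow> solvable T' c X Y f"
  by (auto simp: solvable_def intro: order_trans)

lemma solvable_swap:
  assumes "solvable T c X Y f"
  shows "solvable T c Y X (\<lambda>y x. f x y)"
proof -
  obtain P where P: "steps P \<le> T" "computes_on P (X \<times> Y) f"
      "\<forall>x\<in>X. \<forall>y\<in>Y. nonblanks (run P x y) \<le> c"
    using assms by (auto simp: solvable_def)
  have "computes_on (swap_players P) (Y \<times> X) (\<lambda>y x. f x y)"
    by (rule computes_on_swap_players[OF P(2)])
  moreover have "steps (swap_players P) \<le> T"
    using P(1) by (simp add: swap_players_def)
  ultimately show ?thesis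
    unfolding solvable_def using P(3) by (intro exI[of _ "swap_players P"]) (auto simp: run_swap_players)
qed

lemma solvable_transform:
  assumes "solvable T c X Y f" "\<phi> ` X' \<subseteq> X" "\<psi> ` Y' \<subseteq> Y"
    and "\<And>x y. x \<in> X' \<Longrightarrow> y \<in> Y' \<Longrightarrow> g (f (\<phi> x) (\<psi> y)) = f' x y"
  shows "solvable T c X' Y' f'"
proof -
  obtain P where P: "steps P \<le> T" "computes_on P (X \<times> Y) f"
      "\<forall>x\<in>X. \<forall>y\<in>Y. nonblanks (run P x y) \<le> c"
    using assms(1) by (auto simp: solvable_def)
  have in_XY: "\<phi> x \<in> X" "\<psi> y \<in> Y" if "x \<in> X'" "y \<in> Y'" for x y
    using assms(2,3) that by auto
  have "computes_on (transform_protocol \<phi> \<psi> g P) (X' \<times> Y') f'"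
    using P(2) in_XY assms(4)
    by (auto simp: computes_on_def run_transform_protocol) (auto simp: transform_protocol_def)
  then show ?thesis
    unfolding solvable_def using P(1,3) in_XY
    by (intro exI[of _ "transform_protocol \<phi> \<psi> g P"])
      (auto simp: run_transform_protocol, simp add: transform_protocol_def)
qed

section \<open>The first message\<close>

lemma pigeonhole_card_class:
  assumes "finite S" "finite K" "K \<noteq> {}" "f ` S \<subseteq> K"
  obtains k where "k \<in> K" "card S \<le> card K * card {x \<in> S. f x = k}"
proof (rule ccontr)
  assume "\<not> thesis"
  with that have less: "\<forall>k\<in>K. card K * card {x \<in> S. f x = k} < card S"
    by (meson not_le)
  have "card S = (\<Sum>k\<in>K. card {x \<in> S. f x = k})"
    using sum.group[OF assms(1,2,4), of "\<lambda>_. 1::nat"] by simp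
  then have "card K * card S = (\<Sum>k\<in>K. card K * card {x \<in> S. f x = k})"
    by (simp add: sum_distrib_left)
  also have "\<dots> < (\<Sum>k\<in>K. card S)"
    using less assms by (intro sum_strict_mono) auto
  finally show False
    by simp
qed

abbreviation blanks :: "nat \<Rightarrow> transcript" where
  "blanks t \<equiv> replicate t (None, None)"

text \<open>Only the all-blank history is consulted, so quietness depends on one player's input
  alone. Hence the input pairs with a silent start of length \<open>t\<close> form a
  rectangle.\<close>

definition quiet :: "(transcript \<Rightarrow> symbol) \<Rightarrow> nat \<Rightarrow> bool" where
  "quiet s t \<longleftrightarrow> (\<forall>u<t. s (blanks u) = None)"

lemma quiet_mono: "quiet s t \<Longrightarrow> u \<le> t \<Longrightarrow> quiet s u"
  by (simp add: quiet_def)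

lemma quiet_0 [simp]: "quiet s 0"
  by (simp add: quiet_def)

lemma not_quietE:
  assumes "\<not> quiet s t"
  obtains u where "u < t" "quiet s u" "s (blanks u) \<noteq> None"
proof -
  let ?u = "LEAST u. s (blanks u) \<noteq> None"
  obtain v where v: "v < t" "s (blanks v) \<noteq> None"
    using assms by (auto simp: quiet_def)
  have "s (blanks ?u) \<noteq> None" "?u \<le> v"
    using v(2) by (auto intro: LeastI Least_le)
  moreover have "quiet s ?u"
    unfolding quiet_def using not_less_Least by blast
  moreover have "?u < t"
    using \<open>?u \<le> v\<close> \<open>v < t\<close> by simp
  ultimately show thesis
    using that[of ?u] by blast
qed

lemma run_for_quiet:
  assumes "quiet (alice_send P x) t" "quiet (bob_send P y) t"
  shows "run_for t P x y = blanks t"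
  using assms
proof (induction t)
  case (Suc t)
  then have "run_for t P x y = blanks t"
    by (meson le_SucI order_refl quiet_mono)
  with Suc.prems show ?case
    by (simp add: quiet_def Let_def replicate_append_same)
qed simp

text \<open>Alice's first symbol has at most \<open>2 * steps P\<close> combinations of time and
  bit. Once the most frequent one and Bob's simultaneous symbol are fixed, all remaining pairs share
  the transcript \<open>h\<close>, which uses up at least one symbol. The factors 4 and 6 include
  the 2 from \<open>A\<close> and \<open>B\<close>.\<close>

lemma solvable_after_message:
  fixes P :: "('x, 'y, 'z) protocol"
  assumes "finite X" "finite Y" "t < steps P"
    and "computes_on P (X \<times> Y) f" "\<forall>x\<in>X. \<forall>y\<in>Y. nonblanks (run P x y) \<le> c"
    and A: "card X \<le> 2 * card {x \<in> X. \<not> quiet (alice_send P x) (Suc t)}"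
    and B: "card Y \<le> 2 * card {y \<in> Y. quiet (bob_send P y) t}"
    and "X \<noteq> {}" "Y \<noteq> {}"
  obtains X' Y' where "X' \<subseteq> X" "Y' \<subseteq> Y" "card X \<le> 4 * steps P * card X'" "card Y \<le> 6 * card Y'"
    "c > 0" "solvable (steps P) (c - 1) X' Y' f"
proof -
  define XN where "XN = {x \<in> X. \<not> quiet (alice_send P x) (Suc t)}"
  define YQ where "YQ = {y \<in> Y. quiet (bob_send P y) t}"
  have fin: "finite XN" "finite YQ"
    using assms by (auto simp: XN_def YQ_def)
  have "\<exists>u s. u < Suc t \<and> quiet (alice_send P x) u \<and> alice_send P x (blanks u) = Some s"
    if "x \<in> XN" for x
    using that by (auto simp: XN_def elim!: not_quietE)
  then obtain u s where us: "\<And>x. x \<in> XN \<Longrightarrow>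
      u x < Suc t \<and> quiet (alice_send P x) (u x) \<and> alice_send P x (blanks (u x)) = Some (s x)"
    by metis
  define K where "K = {..<Suc t} \<times> (UNIV :: bool set)"
  have K: "finite K" "K \<noteq> {}" "card K = 2 * Suc t" "(\<lambda>x. (u x, s x)) ` XN \<subseteq> K"
    using us by (auto simp: K_def card_cartesian_product)
  obtain us0 where us0: "us0 \<in> K" "card XN \<le> card K * card {x \<in> XN. (u x, s x) = us0}"
    by (rule pigeonhole_card_class[OF fin(1) K(1,2,4)])
  obtain u0 s0 where u0s0: "us0 = (u0, s0)"
    by fastforce
  define X' where "X' = {x \<in> XN. (u x, s x) = us0}"
  have "card XN \<le> 2 * Suc t * card X'"
    using us0(2) unfolding K(3) X'_def .
  also have "\<dots> \<le> 2 * steps P * card X'"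
    using \<open>t < steps P\<close> by (intro mult_right_mono) auto
  finally have cX: "card X \<le> 4 * steps P * card X'"
    using A by (simp add: XN_def)
  have u0: "u0 < Suc t"
    using us0(1) u0s0 by (auto simp: K_def)
  \<comment> \<open>Bob is only known to be quiet before \<open>t\<close>, so for
    \<open>u0 = t\<close> he may speak together with Alice. His symbol, one of three, has to be
    fixed too.\<close>
  obtain w where w: "card YQ \<le> card (UNIV :: symbol set) * card {y \<in> YQ. bob_send P y (blanks u0) = w}"
    by (rule pigeonhole_card_class[OF fin(2), of UNIV "\<lambda>y. bob_send P y (blanks u0)"]) auto
  define Y' where "Y' = {y \<in> YQ. bob_send P y (blanks u0) = w}"
  have symbols: "card (UNIV :: symbol set) = 3"
    by (simp add: UNIV_option_conv card_image)
  have "card YQ \<le> 3 * card Y'"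
    using w unfolding symbols Y'_def .
  with B have cY: "card Y \<le> 6 * card Y'"
    unfolding YQ_def[symmetric] by linarith
  define h where "h = blanks u0 @ [(Some s0, w)]"
  have len: "length h \<le> steps P"
    using u0 \<open>t < steps P\<close> by (simp add: h_def)
  have runh: "run_for (length h) P x y = h" if "x \<in> X'" "y \<in> Y'" for x y
  proof -
    have "quiet (alice_send P x) u0" "alice_send P x (blanks u0) = Some s0"
      using that us u0s0 by (auto simp: X'_def)
    moreover have "quiet (bob_send P y) u0" "bob_send P y (blanks u0) = w"
      using that u0 quiet_mono[of "bob_send P y" t u0] by (auto simp: Y'_def YQ_def)
    ultimately show ?thesis
      using run_for_quiet[of P x u0 y] by (simp add: h_def)
  qed
  have sub: "X' \<subseteq> X" "Y' \<subseteq> Y"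
    by (auto simp: X'_def XN_def Y'_def YQ_def)
  have run: "run P x y = h @ run (residual h P) x y" if "x \<in> X'" "y \<in> Y'" for x y
    by (rule run_residual[OF runh[OF that] len])
  have nb: "nonblanks h \<ge> 1"
    by (simp add: h_def nonblanks_def)
  have res: "nonblanks h + nonblanks (run (residual h P) x y) \<le> c" if "x \<in> X'" "y \<in> Y'" for x y
  proof -
    have "nonblanks (run P x y) \<le> c"
      using assms(5) that sub by blast
    then show ?thesis
      by (subst (asm) run[OF that]) simp
  qed
  \<comment> \<open>Some pair survives, and its run contains the symbol in \<open>h\<close>; so
    \<open>c - 1\<close> is not truncated.\<close>
  have "X' \<noteq> {}" "Y' \<noteq> {}"
    using cX cY \<open>X \<noteq> {}\<close> \<open>Y \<noteq> {}\<close> card_0_eq[OF \<open>finite X\<close>] card_0_eq[OF \<open>finite Y\<close>]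
    by (metis card.empty le_zero_eq mult_0_right)+
  then obtain x y where "x \<in> X'" "y \<in> Y'"
    by blast
  from res[OF this] nb have "c > 0"
    by linarith
  have "computes_on (residual h P) (X' \<times> Y') f"
    unfolding computes_on_def
  proof (clarify, intro conjI)
    fix x y assume xy: "x \<in> X'" "y \<in> Y'"
    with assms(4) sub have "alice_output P x (run P x y) = f x y" "bob_output P y (run P x y) = f x y"
      by (auto simp: computes_on_def)
    then show "alice_output (residual h P) x (run (residual h P) x y) = f x y"
      "bob_output (residual h P) y (run (residual h P) x y) = f x y"
      unfolding run[OF xy] by (simp_all add: residual_def)
  qed
  moreover have "steps (residual h P) \<le> steps P"
    by (simp add: residual_def)
  moreover have "\<forall>x\<in>X'. \<forall>y\<in>Y'. nonblanks (run (residual h P) x y) \<le> c - 1"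
  proof (intro ballI)
    fix x y assume "x \<in> X'" "y \<in> Y'"
    from res[OF this] nb show "nonblanks (run (residual h P) x y) \<le> c - 1"
      by linarith
  qed
  ultimately have "solvable (steps P) (c - 1) X' Y' f"
    unfolding solvable_def by (intro exI[of _ "residual h P"] conjI)
  with sub cX cY \<open>c > 0\<close> show thesis
    by (rule that)
qed

lemma card_Collect_split:
  "finite S \<Longrightarrow> card S = card {x \<in> S. p x} + card {x \<in> S. \<not> p x}"
  by (subst card_Un_disjoint[symmetric]) (auto intro: arg_cong[where f = card])

text \<open>Consider the last time up to which at least half of each player's inputs are quiet.
  Unless it is the end of the protocol, one more step makes more than half of one player's inputs
  speak, while half of the other player's inputs were quiet until then.\<close>

lemma first_message_cases:
  fixes f :: "'x \<Rightarrow> 'y \<Rightarrow> 'z"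
  assumes "solvable T c X Y f" "finite X" "finite Y" "X \<noteq> {}" "Y \<noteq> {}"
  obtains
    (silent) X' Y' where "X' \<subseteq> X" "Y' \<subseteq> Y" "card X \<le> 2 * card X'" "card Y \<le> 2 * card Y'"
      "\<And>x x' y. x \<in> X' \<Longrightarrow> x' \<in> X' \<Longrightarrow> y \<in> Y' \<Longrightarrow> f x y = f x' y"
  | (alice) X' Y' where "X' \<subseteq> X" "Y' \<subseteq> Y" "card X \<le> 4 * T * card X'" "card Y \<le> 6 * card Y'"
      "c > 0" "solvable T (c - 1) X' Y' f"
  | (bob) X' Y' where "X' \<subseteq> X" "Y' \<subseteq> Y" "card X \<le> 6 * card X'" "card Y \<le> 4 * T * card Y'"
      "c > 0" "solvable T (c - 1) X' Y' f"
proof -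
  obtain P where P: "steps P \<le> T" "computes_on P (X \<times> Y) f"
      "\<forall>x\<in>X. \<forall>y\<in>Y. nonblanks (run P x y) \<le> c"
    using assms by (auto simp: solvable_def)
  define XQ where "XQ t = {x \<in> X. quiet (alice_send P x) t}" for t
  define YQ where "YQ t = {y \<in> Y. quiet (bob_send P y) t}" for t
  define Q where "Q t \<longleftrightarrow> card X \<le> 2 * card (XQ t) \<and> card Y \<le> 2 * card (YQ t)" for t
  have "Q 0"
    by (simp add: Q_def XQ_def YQ_def)
  show thesis
  proof (cases "Q (steps P)")
    case True
    \<comment> \<open>Bob computes the answer from \<open>y\<close> and an all-blank transcript, so
      it cannot depend on \<open>x\<close>.\<close>
    have eq: "f x y = bob_output P y (blanks (steps P))"
      if "x \<in> XQ (steps P)" "y \<in> YQ (steps P)" for x y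
    proof -
      have "run P x y = blanks (steps P)"
        using that unfolding run_def by (intro run_for_quiet) (simp_all add: XQ_def YQ_def)
      moreover have "f x y = bob_output P y (run P x y)"
        using that P(2) by (auto simp: XQ_def YQ_def computes_on_def)
      ultimately show ?thesis
        by simp
    qed
    show thesis
    proof (rule silent[of "XQ (steps P)" "YQ (steps P)"])
      show "card X \<le> 2 * card (XQ (steps P))" "card Y \<le> 2 * card (YQ (steps P))"
        using True by (simp_all add: Q_def)
    qed (auto simp: eq XQ_def[of "steps P"] YQ_def[of "steps P"])
  next
    case False
    with \<open>Q 0\<close> obtain t where t: "t < steps P" "Q t" "\<not> Q (Suc t)"
      using inc_induct[of 0 "steps P" "\<lambda>t. \<not> Q t"] by blast
    have split: "card X = card (XQ (Suc t)) + card {x \<in> X. \<not> quiet (alice_send P x) (Suc t)}"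
        "card Y = card (YQ (Suc t)) + card {y \<in> Y. \<not> quiet (bob_send P y) (Suc t)}"
      unfolding XQ_def YQ_def using assms(2,3) card_Collect_split by fast+
    show thesis
    proof (cases "card X \<le> 2 * card (XQ (Suc t))")
      case True
      then have "card Y \<le> 2 * card {y \<in> Y. \<not> quiet (bob_send P y) (Suc t)}"
        using t(3) split by (auto simp: Q_def)
      let ?P = "swap_players P"
      have send: "alice_send ?P y (blanks u) = bob_send P y (blanks u)"
         "bob_send ?P x (blanks u) = alice_send P x (blanks u)" for x y u
        by (simp_all add: swap_players_def)
      have q: "quiet (alice_send ?P y) u = quiet (bob_send P y) u"
        "quiet (bob_send ?P x) u = quiet (alice_send P x) u" for x y u
        by (simp_all add: quiet_def send)
      have steps: "steps ?P = steps P"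
        by (simp add: swap_players_def)
      have comp: "computes_on ?P (Y \<times> X) (\<lambda>y x. f x y)"
        by (rule computes_on_swap_players[OF P(2)])
      have cost: "\<forall>y\<in>Y. \<forall>x\<in>X. nonblanks (run ?P y x) \<le> c"
        using P(3) by (simp add: run_swap_players)
      have hyps: "t < steps ?P" "card Y \<le> 2 * card {y \<in> Y. \<not> quiet (alice_send ?P y) (Suc t)}"
          "card X \<le> 2 * card {x \<in> X. quiet (bob_send ?P x) t}"
        using \<open>card Y \<le> _\<close> t by (simp_all add: Q_def XQ_def steps q)
      obtain Y' X' where *: "Y' \<subseteq> Y" "X' \<subseteq> X" "card Y \<le> 4 * steps P * card Y'"
        "card X \<le> 6 * card X'" "c > 0" "solvable (steps P) (c - 1) Y' X' (\<lambda>y x. f x y)"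
        by (rule solvable_after_message[OF assms(3,2) hyps(1) comp cost hyps(2,3) assms(5,4),
              unfolded steps])
      have "4 * steps P * card Y' \<le> 4 * T * card Y'"
        using P(1) by (intro mult_right_mono) auto
      with *(3) have "card Y \<le> 4 * T * card Y'"
        by (rule order_trans)
      with * show thesis
        by (intro bob[of X' Y'] solvable_mono[OF solvable_swap[OF *(6)] P(1)])
    next
      case False
      then have "card X \<le> 2 * card {x \<in> X. \<not> quiet (alice_send P x) (Suc t)}"
        using split by auto
      moreover have "card Y \<le> 2 * card {y \<in> Y. quiet (bob_send P y) t}"
        using t by (simp add: Q_def YQ_def)
      ultimately obtain X' Y' where *: "X' \<subseteq> X" "Y' \<subseteq> Y" "card X \<le> 4 * steps P * card X'"
        "card Y \<le> 6 * card Y'" "c > 0" "solvable (steps P) (c - 1) X' Y' f"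
        by (rule solvable_after_message[OF assms(2,3) t(1) P(2,3) _ _ assms(4,5)])
      have "4 * steps P * card X' \<le> 4 * T * card X'"
        using P(1) by (intro mult_right_mono) auto
      with *(3) have "card X \<le> 4 * T * card X'"
        by (rule order_trans)
      with * show thesis
        by (intro alice[of X' Y'] solvable_mono[OF *(6) P(1)])
    qed
  qed
qed

section \<open>Projections of dense sets of tuples\<close>

abbreviation tuples :: "nat \<Rightarrow> 'a set \<Rightarrow> 'a list set" where
  "tuples b S \<equiv> {xs. set xs \<subseteq> S \<and> length xs = b}"

abbreviation proj :: "nat \<Rightarrow> 'a list set \<Rightarrow> 'a set" where
  "proj i Y \<equiv> (\<lambda>ys. ys ! i) ` Y"

lemma nth_tuples: "ys \<in> tuples b S \<Longrightarrow> i < b \<Longrightarrow> ys ! i \<in> S"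
  using nth_mem by blast

text \<open>\<open>Y\<close> embeds into the box with sides \<open>proj i Y\<close> for
  \<open>i \<in> I\<close> and \<open>S\<close> elsewhere.\<close>

lemma card_le_prod_proj:
  assumes "finite S" "Y \<subseteq> tuples b S" "I \<subseteq> {..<b}"
  shows "card Y \<le> (\<Prod>i\<in>I. card (proj i Y)) * card S ^ (b - card I)"
proof -
  let ?F = "\<lambda>i. if i \<in> I then proj i Y else S"
  have nth: "ys ! i \<in> S" if "ys \<in> Y" "i < b" for ys i
    using that assms(2) nth_tuples by blast
  have len: "length ys = b" if "ys \<in> Y" for ys
    using that assms(2) by auto
  have "finite (proj i Y)" if "i < b" for i
    using nth that by (intro finite_subset[OF _ assms(1)]) auto
  then have fin: "finite (PiE {..<b} ?F)"
    using assms(1) by (intro finite_PiE) auto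
  have "inj_on (\<lambda>ys. restrict ((!) ys) {..<b}) Y"
  proof (rule inj_onI)
    fix xs ys
    assume *: "xs \<in> Y" "ys \<in> Y" "restrict ((!) xs) {..<b} = restrict ((!) ys) {..<b}"
    have "xs ! i = ys ! i" if "i < b" for i
      using fun_cong[OF *(3), of i] that by simp
    then show "xs = ys"
      using len[OF *(1)] len[OF *(2)] by (intro nth_equalityI) auto
  qed
  moreover have "(\<lambda>ys. restrict ((!) ys) {..<b}) ` Y \<subseteq> PiE {..<b} ?F"
    using nth by (force simp: PiE_iff extensional_def)
  ultimately have "card Y \<le> card (PiE {..<b} ?F)"
    using card_inj_on_le fin by blast
  also have "\<dots> = (\<Prod>i<b. card (?F i))"
    by (simp add: card_PiE)
  also have "\<dots> = (\<Prod>i<b. if i \<in> I then card (proj i Y) else card S)"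
    by (intro prod.cong) auto
  also have "\<dots> = (\<Prod>i\<in>I. card (proj i Y)) * (\<Prod>i\<in>{..<b} - I. card S)"
    using assms(3) by (subst prod.If_cases) (auto simp: Int_absorb1 Diff_eq)
  also have "(\<Prod>i\<in>{..<b} - I. card S) = card S ^ (b - card I)"
    using assms(3) by (simp add: card_Diff_subset finite_subset)
  finally show ?thesis .
qed

definition dense_in :: "real \<Rightarrow> 'a set \<Rightarrow> 'a set \<Rightarrow> bool" where
  "dense_in \<alpha> S A \<longleftrightarrow> A \<subseteq> S \<and> \<alpha> * real (card S) \<le> real (card A)"

lemma dense_in_mono: "dense_in \<alpha> S A \<Longrightarrow> \<beta> \<le> \<alpha> \<Longrightarrow> dense_in \<beta> S A"
  unfolding dense_in_def by (meson mult_right_mono of_nat_0_le_iff order_trans)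

lemma dense_in_subset:
  assumes "dense_in \<alpha> S A" "A' \<subseteq> A" "real (card A) \<le> k * real (card A')" "k > 0"
  shows "dense_in (\<alpha> / k) S A'"
proof -
  have "\<alpha> * real (card S) \<le> k * real (card A')"
    using assms(1,3) by (auto simp: dense_in_def)
  then show ?thesis
    using assms by (auto simp: dense_in_def field_simps)
qed

lemma card_tuples: "finite S \<Longrightarrow> card (tuples b S) = card S ^ b"
  by (rule card_lists_length_eq)

lemma finite_tuples: "finite S \<Longrightarrow> finite (tuples b S)"
  by (rule finite_lists_length_eq)

lemma proj_subset: "Y \<subseteq> tuples b S \<Longrightarrow> i < b \<Longrightarrow> proj i Y \<subseteq> S"
  using nth_tuples by blast

text \<open>Each value of coordinate \<open>i\<close> extends to at most
  \<open>card S ^ (b - 1)\<close> tuples.\<close>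

lemma dense_in_proj:
  assumes "finite S" "S \<noteq> {}" "i < b" "dense_in \<beta> (tuples b S) Y"
  shows "dense_in \<beta> S (proj i Y)"
proof -
  have Y: "Y \<subseteq> tuples b S" "\<beta> * real (card S) ^ b \<le> real (card Y)"
    using assms(4) by (simp_all add: dense_in_def card_tuples[OF assms(1)])
  have "card Y \<le> card (proj i Y) * card S ^ (b - 1)"
    using card_le_prod_proj[OF assms(1) Y(1), of "{i}"] assms(3) by simp
  then have "real (card Y) \<le> real (card (proj i Y)) * real (card S) ^ (b - 1)"
    by (metis of_nat_le_iff of_nat_mult of_nat_power)
  moreover have "real (card S) ^ b = real (card S) * real (card S) ^ (b - 1)"
    using assms(3) by (cases b) auto
  ultimately have "\<beta> * real (card S) * real (card S) ^ (b - 1)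
      \<le> real (card (proj i Y)) * real (card S) ^ (b - 1)"
    using Y(2) by simp
  moreover have "real (card S) ^ (b - 1) > 0"
    using assms(1,2) by (simp add: card_gt_0_iff)
  ultimately show ?thesis
    using proj_subset[OF Y(1) assms(3)] by (simp add: dense_in_def)
qed

text \<open>Every sparse coordinate at least halves the box around \<open>Y\<close>. So for \<beta>
  > 0 there are at most \<open>log 2 (1/\<beta>)\<close> of them, independently of \<open>b\<close>:
  this makes a short message worthless for most subtrees.\<close>

lemma card_sparse_proj_le:
  assumes "finite S" "S \<noteq> {}" "dense_in \<beta> (tuples b S) Y"
  shows "2 ^ card {i. i < b \<and> \<not> dense_in (1/2) S (proj i Y)} * \<beta> \<le> 1"
proof -
  have Y: "Y \<subseteq> tuples b S" "\<beta> * real (card S) ^ b \<le> real (card Y)"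
    using assms(3) by (simp_all add: dense_in_def card_tuples[OF assms(1)])
  define I where "I = {i. i < b \<and> \<not> dense_in (1/2) S (proj i Y)}"
  have I: "I \<subseteq> {..<b}"
    by (auto simp: I_def)
  then have cI: "card I \<le> b"
    using card_mono[OF _ I] by simp
  have small: "real (card (proj i Y)) \<le> real (card S) / 2" if "i \<in> I" for i
    using that proj_subset[OF Y(1)] by (auto simp: I_def dense_in_def)
  have "real (card Y) \<le> (\<Prod>i\<in>I. real (card (proj i Y))) * real (card S) ^ (b - card I)"
    using card_le_prod_proj[OF assms(1) Y(1) I]
    by (metis of_nat_le_iff of_nat_mult of_nat_power of_nat_prod)
  also have "\<dots> \<le> (\<Prod>i\<in>I. real (card S) / 2) * real (card S) ^ (b - card I)"
    using small by (intro mult_right_mono prod_mono) auto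
  also have "\<dots> = real (card S) ^ b / 2 ^ card I"
    using cI by (simp add: power_divide flip: power_add)
  finally have "\<beta> * real (card S) ^ b \<le> real (card S) ^ b / 2 ^ card I"
    using Y(2) by simp
  moreover have "real (card S) ^ b > 0"
    using assms(1,2) by (simp add: card_gt_0_iff)
  ultimately show ?thesis
    by (simp add: I_def field_simps)
qed

section \<open>Pointer jumping on a tree\<close>

text \<open>
  The two players own the inner nodes of a complete \<open>b\<close>-ary tree alternately, level by level, and
  the owner of a node knows the child that it points to. \<open>Own\<close> and \<open>Other\<close> are the inputs of the
  player that owns the root and of the other one; passing to a subtree exchanges these roles.
\<close>

datatype labels = Leaf | Own nat "labels list" | Other "labels list"

fun own_labels :: "nat \<Rightarrow> nat \<Rightarrow> labels set" and other_labels :: "nat \<Rightarrow> nat \<Rightarrow> labels set" where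
  "own_labels b 0 = {Leaf}"
| "other_labels b 0 = {Leaf}"
| "own_labels b (Suc d) = (\<lambda>(i, xs). Own i xs) ` ({..<b} \<times> tuples b (other_labels b d))"
| "other_labels b (Suc d) = Other ` tuples b (own_labels b d)"

text \<open>The answer is the whole path: its first entry reveals the owner's pointer, and its tail
  is the answer for the subtree. The arguments change places in the recursive call because the owner
  does.\<close>

fun jump :: "nat \<Rightarrow> labels \<Rightarrow> labels \<Rightarrow> nat list" where
  "jump (Suc d) (Own i xs) (Other ys) = i # jump d (ys ! i) (xs ! i)"
| "jump _ _ _ = []"

lemma finite_labels [simp]: "finite (own_labels b d)" "finite (other_labels b d)"
  by (induction d) (auto intro!: finite_imageI finite_cartesian_product finite_tuples)

lemma tuples_nonempty: "S \<noteq> {} \<Longrightarrow> tuples b S \<noteq> {}"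
proof -
  assume "S \<noteq> {}"
  then obtain s where "s \<in> S"
    by blast
  then have "replicate b s \<in> tuples b S"
    by auto
  then show ?thesis
    by blast
qed

lemma labels_nonempty:
  assumes "b > 0"
  shows "own_labels b d \<noteq> {}" "other_labels b d \<noteq> {}"
proof (induction d)
  case (Suc d)
  { case 1 show ?case using Suc assms tuples_nonempty[of "other_labels b d" b] by auto }
  { case 2 show ?case using Suc tuples_nonempty[of "own_labels b d" b] by auto }
qed auto

section \<open>Densities at the root and in its subtrees\<close>

lemma card_own_labels_Suc: "card (own_labels b (Suc d)) = b * card (other_labels b d) ^ b"
proof -
  have "inj_on (\<lambda>(i, xs). Own i xs) ({..<b} \<times> tuples b (other_labels b d))"
    by (auto intro!: inj_onI)
  then show ?thesis
    by (simp add: card_image card_cartesian_product card_tuples)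
qed

abbreviation own_part :: "nat \<Rightarrow> labels set \<Rightarrow> labels list set" where
  "own_part i X \<equiv> {xs. Own i xs \<in> X}"

abbreviation other_part :: "labels set \<Rightarrow> labels list set" where
  "other_part Y \<equiv> {ys. Other ys \<in> Y}"

lemma dense_in_other_part:
  assumes "dense_in \<beta> (other_labels b (Suc d)) Y"
  shows "dense_in \<beta> (tuples b (own_labels b d)) (other_part Y)"
proof -
  have Y: "Y = Other ` other_part Y"
    using assms by (auto simp: dense_in_def)
  have "card Y = card (other_part Y)"
    by (subst Y) (simp add: card_image inj_on_def)
  then show ?thesis
    using assms by (auto simp: dense_in_def card_tuples card_image inj_on_def)
qed

lemma own_part_subset: "X \<subseteq> own_labels b (Suc d) \<Longrightarrow> own_part i X \<subseteq> tuples b (other_labels b d)"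
  by auto

lemma card_eq_sum_own_part:
  assumes "X \<subseteq> own_labels b (Suc d)"
  shows "card X = (\<Sum>i<b. card (own_part i X))"
proof -
  have X: "X = (\<Union>i<b. Own i ` own_part i X)"
  proof
    show "X \<subseteq> (\<Union>i<b. Own i ` own_part i X)"
    proof
      fix x assume "x \<in> X"
      moreover from this obtain i xs where "i < b" "x = Own i xs"
        using assms by auto
      ultimately show "x \<in> (\<Union>i<b. Own i ` own_part i X)"
        by blast
    qed
  qed auto
  have fin: "finite (own_part i X)" for i
    by (rule finite_subset[OF own_part_subset[OF assms] finite_tuples[OF finite_labels(2)]])
  have "card X = (\<Sum>i<b. card (Own i ` own_part i X))"
    by (subst X, rule card_UN_disjoint) (auto simp: fin)
  then show ?thesis
    by (simp add: card_image inj_on_def)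
qed

text \<open>Averaging: \<alpha> is at most the mean density of the \<open>b\<close> parts, to which
  parts outside \<open>H\<close> contribute at most \<alpha>/2 and each of the others at most
  \<open>1 / b\<close>.\<close>

lemma card_dense_own_part_ge:
  assumes "b > 0" "dense_in \<alpha> (own_labels b (Suc d)) X"
  shows "\<alpha> * b / 2
    \<le> card {i. i < b \<and> dense_in (\<alpha>/2) (tuples b (other_labels b d)) (own_part i X)}"
proof -
  let ?T = "tuples b (other_labels b d)" and ?s = "real (card (other_labels b d) ^ b)"
  define H where "H = {i. i < b \<and> dense_in (\<alpha>/2) ?T (own_part i X)}"
  have X: "X \<subseteq> own_labels b (Suc d)" "\<alpha> * (b * ?s) \<le> card X"
    using assms(2) unfolding dense_in_def card_own_labels_Suc by auto
  have s: "?s > 0"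
    using labels_nonempty[OF assms(1)] by (simp add: card_gt_0_iff)
  have le: "real (card (own_part i X)) \<le> ?s" for i
    using card_mono[OF finite_tuples own_part_subset[OF X(1)]] by (simp add: card_tuples)
  have light: "real (card (own_part i X)) \<le> \<alpha>/2 * ?s" if "i < b" "i \<notin> H" for i
    using that own_part_subset[OF X(1), of i] by (simp add: H_def dense_in_def card_tuples)
  show ?thesis
  proof (cases "\<alpha> \<ge> 0")
    case True
    have "real (card X) = (\<Sum>i<b. real (card (own_part i X)))"
      using card_eq_sum_own_part[OF X(1)] by simp
    also have "\<dots> \<le> (\<Sum>i<b. (if i \<in> H then ?s else 0) + \<alpha>/2 * ?s)"
    proof (rule sum_mono)
      fix i assume "i \<in> {..<b}"
      moreover have "0 \<le> \<alpha>/2 * ?s"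
        using True s by simp
      ultimately show "real (card (own_part i X)) \<le> (if i \<in> H then ?s else 0) + \<alpha>/2 * ?s"
        using le[of i] light[of i] by (cases "i \<in> H") (auto intro: add_increasing2)
    qed
    also have "\<dots> = (\<Sum>i<b. if i \<in> H then ?s else 0) + b * (\<alpha>/2 * ?s)"
      by (simp add: sum.distrib)
    also have "(\<Sum>i<b. if i \<in> H then ?s else 0) = card H * ?s"
      by (subst sum.inter_filter[symmetric])
        (auto simp: H_def intro!: arg_cong[where f = card])
    finally have "\<alpha> * b * ?s \<le> (real (card H) + \<alpha>/2 * b) * ?s"
      using X(2) by (simp add: algebra_simps)
    then have "\<alpha> * b \<le> real (card H) + \<alpha>/2 * b"
      using s by (simp only: mult_le_cancel_right_pos)
    then show ?thesis
      by (simp add: H_def)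
  next
    case False
    then have "\<alpha> * b / 2 \<le> 0"
      by (simp add: mult_nonpos_nonneg)
    also have "(0::real) \<le> card H"
      by simp
    finally show ?thesis
      by (simp add: H_def)
  qed
qed

text \<open>Some part reaches the average. No density is lost, but there is no choice of
  \<open>i\<close>.\<close>

lemma ex_dense_own_part:
  assumes "b > 0" "dense_in \<alpha> (own_labels b (Suc d)) X"
  obtains i where "i < b" "dense_in \<alpha> (tuples b (other_labels b d)) (own_part i X)"
proof (rule ccontr)
  assume "\<not> thesis"
  with that have no_dense: "\<not> dense_in \<alpha> (tuples b (other_labels b d)) (own_part i X)" if "i < b" for i
    using \<open>i < b\<close> by blast
  let ?s = "real (card (other_labels b d) ^ b)"
  have X: "X \<subseteq> own_labels b (Suc d)" "\<alpha> * (b * ?s) \<le> card X"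
    using assms(2) unfolding dense_in_def card_own_labels_Suc by auto
  have "real (card (own_part i X)) < \<alpha> * ?s" if "i < b" for i
    using no_dense[OF that] own_part_subset[OF X(1), of i] by (simp add: dense_in_def card_tuples)
  then have "(\<Sum>i<b. real (card (own_part i X))) < (\<Sum>i<b. \<alpha> * ?s)"
    using assms(1) by (intro sum_strict_mono) auto
  then show False
    using X(2) card_eq_sum_own_part[OF X(1)] by (simp add: algebra_simps)
qed

text \<open>Each player completes an input on the subtree of child \<open>i\<close> to a fixed input
  in \<open>Y\<close> or \<open>X\<close> on the whole tree, picked by \<open>inv_into\<close>. The
  owner's pointer is set to \<open>i\<close>, and \<open>tl\<close> removes it from the
  answer.\<close>

lemma solvable_subtree:
  assumes "solvable T c X Y (jump (Suc d))"
  shows "solvable T c (proj i (other_part Y)) (proj i (own_part i X)) (jump d)"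
proof (rule solvable_transform[OF solvable_swap[OF assms]])
  let ?\<phi> = "\<lambda>z. Other (inv_into (other_part Y) (\<lambda>ys. ys ! i) z)"
  let ?\<psi> = "\<lambda>z. Own i (inv_into (own_part i X) (\<lambda>xs. xs ! i) z)"
  show "?\<phi> ` proj i (other_part Y) \<subseteq> Y" "?\<psi> ` proj i (own_part i X) \<subseteq> X"
    using inv_into_into[of _ "\<lambda>ys. ys ! i" "other_part Y"]
      inv_into_into[of _ "\<lambda>xs. xs ! i" "own_part i X"] by (simp_all add: image_subset_iff)
  show "tl (jump (Suc d) (?\<psi> x) (?\<phi> y)) = jump d y x"
    if "y \<in> proj i (other_part Y)" "x \<in> proj i (own_part i X)" for x y
    using f_inv_into_f[OF that(1)] f_inv_into_f[OF that(2)] by simp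
qed

text \<open>The densities survive but change places. This spends a level in order to let the
  receiver of a message own the current node.\<close>

lemma descend:
  assumes "b > 0" "solvable T c X Y (jump (Suc d))"
    and "dense_in \<alpha> (own_labels b (Suc d)) X" "dense_in \<beta> (other_labels b (Suc d)) Y"
  obtains X' Y' where "dense_in \<beta> (own_labels b d) X'" "dense_in \<alpha> (other_labels b d) Y'"
    "solvable T c X' Y' (jump d)"
proof -
  obtain i where "i < b" "dense_in \<alpha> (tuples b (other_labels b d)) (own_part i X)"
    using ex_dense_own_part[OF assms(1,3)] .
  then show thesis
    using that[of "proj i (other_part Y)" "proj i (own_part i X)"] solvable_subtree[OF assms(2)]
      labels_nonempty[OF assms(1)] dense_in_other_part[OF assms(4)]
    by (simp add: dense_in_proj)
qed

text \<open>
  The hypothesis ensures that the owner of the root has more dense parts than the other player has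
  sparse projections.
\<close>

lemma descend_restoring:
  assumes "b > 0" "solvable T c X Y (jump (Suc d))"
    and "dense_in \<alpha> (own_labels b (Suc d)) X" "dense_in \<beta> (other_labels b (Suc d)) Y"
    and "\<beta> > 0" "1 < 2 powr (\<alpha> * b / 2) * \<beta>"
  obtains X' Y' where "dense_in (1/2) (own_labels b d) X'" "dense_in (\<alpha>/2) (other_labels b d) Y'"
    "solvable T c X' Y' (jump d)"
proof -
  define H where "H = {i. i < b \<and> dense_in (\<alpha>/2) (tuples b (other_labels b d)) (own_part i X)}"
  define B where "B = {i. i < b \<and> \<not> dense_in (1/2) (own_labels b d) (proj i (other_part Y))}"
  have "2 ^ card B * \<beta> \<le> 1"
    unfolding B_def
    using card_sparse_proj_le[OF finite_labels(1) labels_nonempty(1)[OF assms(1)]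
        dense_in_other_part[OF assms(4)]] .
  also have "1 < 2 powr (\<alpha> * b / 2) * \<beta>"
    by fact
  finally have "2 powr (card B) < 2 powr (\<alpha> * b / 2)"
    using \<open>\<beta> > 0\<close> by (simp add: powr_realpow)
  then have "card B < \<alpha> * b / 2"
    by simp
  also have "\<dots> \<le> card H"
    unfolding H_def using card_dense_own_part_ge[OF assms(1,3)] .
  finally have "\<not> H \<subseteq> B"
    using card_mono[of B H] by (auto simp: B_def)
  then obtain i where "i < b" "dense_in (\<alpha>/2) (tuples b (other_labels b d)) (own_part i X)"
      "dense_in (1/2) (own_labels b d) (proj i (other_part Y))"
    by (auto simp: H_def B_def)
  then show thesis
    using that[of "proj i (other_part Y)" "proj i (own_part i X)"] solvable_subtree[OF assms(2)]
      labels_nonempty[OF assms(1)]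
    by (simp add: dense_in_proj)
qed

section \<open>The lower bound for pointer jumping\<close>

lemma dense_in_finite: "dense_in \<alpha> S A \<Longrightarrow> finite S \<Longrightarrow> finite A"
  by (auto simp: dense_in_def intro: finite_subset)

lemma dense_in_nonempty:
  assumes "dense_in \<alpha> S A" "\<alpha> > 0" "finite S" "S \<noteq> {}"
  shows "A \<noteq> {}"
proof
  assume "A = {}"
  then have "\<alpha> * real (card S) \<le> 0"
    using assms(1) by (simp add: dense_in_def)
  moreover have "\<alpha> * real (card S) > 0"
    using assms by (simp add: card_gt_0_iff)
  ultimately show False
    by simp
qed

text \<open>The hypotheses are what a message leaves of density 1/4: \<open>1/4/6\<close> for the
  receiver, who owns the root here, and \<open>1/4/(4 * T)\<close> for the sender. The first descent
  raises the sender to 1/2 and halves the receiver to 1/48; the second, with exchanged roles, raises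
  the receiver to 1/2 and halves the sender to 1/4.\<close>

lemma restore_density:
  assumes "192 < b" "1 \<le> T" "16 * real T < 2 powr (b / 48)"
    and "solvable T' c X Y (jump (Suc (Suc d)))"
    and "dense_in (1/24) (own_labels b (Suc (Suc d))) X"
    and "dense_in (1/(16 * real T)) (other_labels b (Suc (Suc d))) Y"
  obtains X' Y' where "dense_in (1/4) (own_labels b d) X'" "dense_in (1/4) (other_labels b d) Y'"
    "solvable T' c X' Y' (jump d)"
proof -
  have b: "b > 0"
    using assms(1) by simp
  have T: "1 / (16 * real T) > 0"
    using assms(2) by simp
  have "1/24 * real b / 2 = b / 48"
    by simp
  then have "1 < 2 powr (1/24 * real b / 2) * (1 / (16 * real T))"
    using assms(2,3) by (simp only:) (simp add: field_simps)
  then obtain X1 Y1 where 1: "dense_in (1/2) (own_labels b (Suc d)) X1"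
      "dense_in (1/24/2) (other_labels b (Suc d)) Y1" "solvable T' c X1 Y1 (jump (Suc d))"
    using descend_restoring[OF b assms(4,5,6) T] by metis
  \<comment> \<open>In the second descent \<beta> = 1/48, and \<open>b > 192\<close> makes the
    exponent \<open>b / 4\<close> larger than 48, where 6 would suffice.\<close>
  have "(48::real) < 2 powr 6"
    by (simp add: powr_numeral)
  also have "\<dots> \<le> 2 powr (1/2 * real b / 2)"
    using assms(1) by (intro powr_mono) auto
  finally have "1 < 2 powr (1/2 * real b / 2) * (1/24/2)"
    by simp
  then obtain X2 Y2 where 2: "dense_in (1/2) (own_labels b d) X2"
      "dense_in (1/2/2) (other_labels b d) Y2" "solvable T' c X2 Y2 (jump d)"
    using descend_restoring[OF b 1(3,1,2)] by auto
  have "dense_in (1/4) (own_labels b d) X2" "dense_in (1/4) (other_labels b d) Y2"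
    using dense_in_mono[OF 2(1)] dense_in_mono[OF 2(2)] by simp_all
  then show thesis
    using that 2(3) by blast
qed

text \<open>
  A message costs its sender a factor \<open>O(T)\<close> of density. At most three levels further down, at a
  node owned by the receiver, the sender's density has become constant again, so that the tree must
  have at most three levels per message.
\<close>

lemma pointer_jumping_lower_bound:
  assumes "1 \<le> T" "16 * real T < 2 powr (b / 48)"
    and "dense_in (1/4) (own_labels b d) X" "dense_in (1/4) (other_labels b d) Y" "3 * c < d"
  shows "\<not> solvable T c X Y (jump d)"
  using assms(3-5)
proof (induction c arbitrary: d X Y rule: less_induct)
  case (less c)
  \<comment> \<open>As \<open>T \<ge> 1\<close>, the bound on \<open>T\<close> also forces
    \<open>b > 4 * 48 = 192\<close>.\<close>
  have "2 powr 4 = (16::real)"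
    by (simp add: powr_numeral)
  also have "\<dots> \<le> 16 * real T"
    using assms(1) by simp
  finally have "(2::real) powr 4 < 2 powr (b / 48)"
    using assms(2) by linarith
  then have "4 < real b / 48"
    by (rule iffD1[OF powr_less_cancel_iff, rotated]) simp
  then have b: "192 < b"
    by simp
  then have b0: "b > 0"
    by simp
  note nonempty = labels_nonempty[OF b0]
  have XY: "finite X" "finite Y" "X \<noteq> {}" "Y \<noteq> {}"
    using dense_in_finite[OF less.prems(1)] dense_in_finite[OF less.prems(2)]
      dense_in_nonempty[OF less.prems(1)] dense_in_nonempty[OF less.prems(2)] nonempty by simp_all
  show ?case
  proof
    assume "solvable T c X Y (jump d)"
    then show False
      using XY
    proof (cases rule: first_message_cases)
      \<comment> \<open>The answer does not depend on the owner's input, yet \<open>X'\<close> still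
        allows two different pointers, which are first entries of answers.\<close>
      case (silent X' Y')
      obtain d' where d: "d = Suc d'"
        using less.prems(3) by (cases d) auto
      have "dense_in (1/4/2) (own_labels b d) X'"
        using silent(3) by (intro dense_in_subset[OF less.prems(1) silent(1)]) simp_all
      note card_dense_own_part_ge[OF b0 this[unfolded d]]
      moreover define H where
        "H = {i. i < b \<and> dense_in (1/4/2/2) (tuples b (other_labels b d')) (own_part i X')}"
      \<comment> \<open>The lower bound is \<open>1/8 * b / 2 = b / 16 > 12\<close>.\<close>
      ultimately have "card H > 1"
        using b by simp
      then obtain i j where ij: "i \<in> H" "j \<in> H" "i \<noteq> j"
        by (metis One_nat_def card_le_Suc0_iff_eq card.infinite leD less_imp_le_nat not_less_zero)
      have "own_part k X' \<noteq> {}" if "k \<in> H" for k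
      proof -
        have "dense_in (1/4/2/2) (tuples b (other_labels b d')) (own_part k X')"
          using that by (simp add: H_def)
        from dense_in_nonempty[OF this _ finite_tuples[OF finite_labels(2)] tuples_nonempty[OF nonempty(2)]]
        show ?thesis
          by simp
      qed
      with ij obtain xs xs' where xs: "Own i xs \<in> X'" "Own j xs' \<in> X'"
        by blast
      have "dense_in (1/4/2) (other_labels b d) Y'"
        using silent(4) by (intro dense_in_subset[OF less.prems(2) silent(2)]) simp_all
      then have "Y' \<noteq> {}" "Y' \<subseteq> other_labels b d"
        using dense_in_nonempty nonempty by (fastforce simp: dense_in_def)+
      then obtain y where "y \<in> Y'" "y \<in> other_labels b d"
        by blast
      then obtain ys where "Other ys \<in> Y'"
        by (auto simp: d)
      from silent(5)[OF xs this] ij(3) show False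
        by (simp add: d)
    next
      \<comment> \<open>\<open>X\<close> always belongs to the owner of the root, so the owner is
        the sender. One level makes the receiver the owner, and restoring takes two more.\<close>
      case (alice X' Y')
      obtain d' where d: "d = Suc (Suc (Suc d'))" "3 * (c - 1) < d'"
        using less.prems(3) alice(5) by (intro that[of "d - 3"]) auto
      have "real (card X) \<le> (4 * real T) * real (card X')" "real (card Y) \<le> 6 * real (card Y')"
        using alice(3,4) by (metis of_nat_le_iff of_nat_mult of_nat_numeral)+
      then have dense: "dense_in (1/4/(4 * real T)) (own_labels b d) X'"
          "dense_in (1/4/6) (other_labels b d) Y'"
        using assms(1) by (intro dense_in_subset[OF less.prems(1) alice(1)]
            dense_in_subset[OF less.prems(2) alice(2)]; simp)+
      obtain X1 Y1 where 1: "dense_in (1/4/6) (own_labels b (Suc (Suc d'))) X1"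
          "dense_in (1/4/(4 * real T)) (other_labels b (Suc (Suc d'))) Y1"
          "solvable T (c - 1) X1 Y1 (jump (Suc (Suc d')))"
        using descend[OF b0 alice(6)[unfolded d(1)] dense[unfolded d(1)]] .
      obtain X2 Y2 where "dense_in (1/4) (own_labels b d') X2" "dense_in (1/4) (other_labels b d') Y2"
          "solvable T (c - 1) X2 Y2 (jump d')"
        using restore_density[OF b assms(1,2) 1(3)] 1(1,2) by auto
      then show False
        using less.IH[OF _ _ _ d(2)] alice(5) by auto
    next
      \<comment> \<open>The receiver owns the root already, so two levels suffice.\<close>
      case (bob X' Y')
      obtain d' where d: "d = Suc (Suc d')" "3 * (c - 1) < d'"
        using less.prems(3) bob(5) by (intro that[of "d - 2"]) auto
      have "real (card X) \<le> 6 * real (card X')" "real (card Y) \<le> (4 * real T) * real (card Y')"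
        using bob(3,4) by (metis of_nat_le_iff of_nat_mult of_nat_numeral)+
      then have dense: "dense_in (1/4/6) (own_labels b d) X'"
          "dense_in (1/4/(4 * real T)) (other_labels b d) Y'"
        using assms(1) by (intro dense_in_subset[OF less.prems(1) bob(1)]
            dense_in_subset[OF less.prems(2) bob(2)]; simp)+
      obtain X2 Y2 where "dense_in (1/4) (own_labels b d') X2" "dense_in (1/4) (other_labels b d') Y2"
          "solvable T (c - 1) X2 Y2 (jump d')"
        using restore_density[OF b assms(1,2) bob(6)[unfolded d(1)]] dense[unfolded d(1)] by auto
      then show False
        using less.IH[OF _ _ _ d(2)] bob(5) by auto
    qed
  qed
qed

section \<open>Pointer jumping as a median problem\<close>

lemma nth_sorted_list_of_multiset_eqI:
  fixes M :: "'a::linorder multiset"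
  assumes "size {#x \<in># M. x < v#} \<le> k" "k < size {#x \<in># M. x \<le> v#}"
  shows "sorted_list_of_multiset M ! k = v"
proof -
  define xs where "xs = sorted_list_of_multiset M"
  have size_filter: "size (filter_mset p M) = card {i. i < length xs \<and> p (xs ! i)}" for p
  proof -
    have "size (filter_mset p M) = length (filter p xs)"
      by (metis mset_filter mset_sorted_list_of_multiset size_mset xs_def)
    then show ?thesis
      by (simp add: length_filter_conv_card)
  qed
  have sorted: "xs ! i \<le> xs ! j" if "i \<le> j" "j < length xs" for i j
    using that sorted_nth_mono[of xs i j] by (simp add: xs_def)
  have k: "k < length xs"
    using assms(2) size_filter_mset_lesseq[of "\<lambda>x. x \<le> v" M]
    by (metis less_le_trans mset_sorted_list_of_multiset size_mset xs_def)
  have "\<not> xs ! k < v"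
  proof
    assume "xs ! k < v"
    then have "{..k} \<subseteq> {i. i < length xs \<and> xs ! i < v}"
      using sorted k by (auto intro: le_less_trans)
    from card_mono[OF _ this] show False
      using assms(1) by (simp add: size_filter)
  qed
  moreover have "\<not> v < xs ! k"
  proof
    assume "v < xs ! k"
    have "{i. i < length xs \<and> xs ! i \<le> v} \<subseteq> {..<k}"
    proof clarify
      fix i assume "i < length xs" "xs ! i \<le> v"
      then show "i < k"
        using sorted[of k i] \<open>v < xs ! k\<close> by (meson leD leI order_trans)
    qed
    from card_mono[OF _ this] show False
      using assms(2) by (simp add: size_filter)
  qed
  ultimately show ?thesis
    by (simp add: xs_def)
qed

lemma median_eqI:
  assumes "finite A" "finite B"
    and "card {a \<in> A. a < v} + card {a \<in> B. a < v} \<le> (card A + card B - 1) div 2"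
    and "(card A + card B - 1) div 2 < card {a \<in> A. a \<le> v} + card {a \<in> B. a \<le> v}"
  shows "median A B = v"
  using assms unfolding median_def multiset_median_def
  by (intro nth_sorted_list_of_multiset_eqI) (simp_all add: filter_mset_mset_set)

text \<open>The blocks of length \<open>w\<close> start at \<open>2 * b * w\<close> to leave room
  for the lower padding.\<close>

definition blocks :: "nat \<Rightarrow> nat \<Rightarrow> (nat \<Rightarrow> nat set) \<Rightarrow> nat set" where
  "blocks b w S = (\<Union>j<b. (+) ((2 * b + j) * w) ` S j)"

text \<open>The blocks are disjoint because \<open>a div w\<close> recovers the block of
  \<open>a\<close>.\<close>

lemma card_blocks_filter:
  assumes "\<And>j. j < b \<Longrightarrow> S j \<subseteq> {..<w}"
  shows "card {a \<in> blocks b w S. p a} = (\<Sum>j<b. card {s \<in> S j. p ((2 * b + j) * w + s)})"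
proof -
  let ?I = "\<lambda>j. (+) ((2 * b + j) * w) ` {s \<in> S j. p ((2 * b + j) * w + s)}"
  have div: "a div w = 2 * b + j" if j: "j < b" and a: "a \<in> ?I j" for a j
  proof -
    obtain s where "s \<in> S j" "a = (2 * b + j) * w + s"
      using a by blast
    moreover from this have "s < w"
      using assms[OF j] by auto
    ultimately show ?thesis
      by simp
  qed
  have "{a \<in> blocks b w S. p a} = (\<Union>j<b. ?I j)"
    by (auto simp: blocks_def)
  then have "card {a \<in> blocks b w S. p a} = card (\<Union>j<b. ?I j)"
    by (rule arg_cong)
  also have "\<dots> = (\<Sum>j<b. card (?I j))"
  proof (rule card_UN_disjoint)
    show "\<forall>j\<in>{..<b}. finite (?I j)"
      using assms by (auto intro: finite_subset)
    show "\<forall>i\<in>{..<b}. \<forall>j\<in>{..<b}. i \<noteq> j \<longrightarrow> ?I i \<inter> ?I j = {}"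
    proof (intro ballI impI, rule ccontr)
      fix i j assume "i \<in> {..<b}" "j \<in> {..<b}" "i \<noteq> j" "?I i \<inter> ?I j \<noteq> {}"
      then obtain a where "a \<in> ?I i" "a \<in> ?I j"
        by blast
      then show False
        using div[of i a] div[of j a] \<open>i \<in> {..<b}\<close> \<open>j \<in> {..<b}\<close> \<open>i \<noteq> j\<close> by auto
    qed
  qed simp
  also have "\<dots> = (\<Sum>j<b. card {s \<in> S j. p ((2 * b + j) * w + s)})"
    by (intro sum.cong card_image) auto
  finally show ?thesis .
qed

lemma blocks_bounds:
  assumes "\<And>j. j < b \<Longrightarrow> S j \<subseteq> {..<w}" "a \<in> blocks b w S"
  shows "2 * b * w \<le> a" "a < 3 * b * w"
proof -
  obtain j s where *: "j < b" "s \<in> S j" "a = (2 * b + j) * w + s"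
    using assms(2) by (auto simp: blocks_def)
  with assms(1) have "s < w"
    by auto
  then have "a < (2 * b + j + 1) * w"
    using *(3) by simp
  also have "\<dots> \<le> 3 * b * w"
    using *(1) by (intro mult_right_mono) auto
  finally show "a < 3 * b * w" .
  show "2 * b * w \<le> a"
    using *(3) by (simp add: algebra_simps)
qed

lemma card_blocks_below:
  assumes "\<And>j. j < b \<Longrightarrow> S j \<subseteq> {..<w}" "i < b" "u \<le> w"
  shows "card {a \<in> blocks b w S. a < (2 * b + i) * w + u}
    = (\<Sum>j<i. card (S j)) + card {s \<in> S i. s < u}"
proof -
  have summand: "{s \<in> S j. (2 * b + j) * w + s < (2 * b + i) * w + u}
      = (if j < i then S j else if j = i then {s \<in> S i. s < u} else {})" if "j < b" for j
  proof -
    have less: "(2 * b + k) * w + w \<le> (2 * b + l) * w" if "k < l" for k l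
      using mult_right_mono[of "2 * b + k + 1" "2 * b + l" w] that by simp
    consider "j < i" | "j = i" | "i < j"
      by linarith
    then show ?thesis
    proof cases
      case 1
      then show ?thesis
        using less[OF 1] assms(1)[OF \<open>j < b\<close>] by fastforce
    next
      case 3
      then show ?thesis
        using less[OF 3] assms(3) by auto
    qed auto
  qed
  have "card {a \<in> blocks b w S. a < (2 * b + i) * w + u}
      = (\<Sum>j<b. card {s \<in> S j. (2 * b + j) * w + s < (2 * b + i) * w + u})"
    by (rule card_blocks_filter) (rule assms(1))
  also have "\<dots> = (\<Sum>j<b. card (if j < i then S j else if j = i then {s \<in> S i. s < u} else {}))"
    by (intro sum.cong) (simp_all only: summand lessThan_iff)
  also have "\<dots> = (\<Sum>j<Suc i. card (if j < i then S j else if j = i then {s \<in> S i. s < u} else {}))"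
    using assms(2) by (intro sum.mono_neutral_right) auto
  also have "\<dots> = (\<Sum>j<i. card (S j)) + card {s \<in> S i. s < u}"
    by simp
  finally show ?thesis .
qed

text \<open>
  The instances for the subtrees are put into consecutive blocks, each of which contains
  \<open>t\<close> elements of the two players together, whatever their inputs are. The owner of the root moves
  the median into the middle of block \<open>i\<close> by adding \<open>t * (b - 1)\<close> elements, \<open>t * i\<close> of them above
  and the other ones below all blocks. So the median problem is solved recursively in block \<open>i\<close>.
\<close>

definition total :: "nat \<Rightarrow> nat \<Rightarrow> nat" where
  "total b d = 2 * (2 * b - 1) ^ d"

text \<open>\<open>5 * b = 2 * b + b + 2 * b\<close> for lower padding, blocks and upper padding, in
  units of the width one level below. Each padding has at most
  \<open>b * total b d \<le> 2 * b * width b d\<close> elements.\<close>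

definition width :: "nat \<Rightarrow> nat \<Rightarrow> nat" where
  "width b d = (5 * b) ^ d"

text \<open>Both players use the same blocks and the same leaf element 0; common elements are
  harmless because the multiset union counts them twice.\<close>

fun encode :: "nat \<Rightarrow> nat \<Rightarrow> labels \<Rightarrow> nat set" where
  "encode b 0 _ = {0}"
| "encode b (Suc d) (Own i xs) = {..<total b d * (b - 1 - i)}
     \<union> {3 * b * width b d..<3 * b * width b d + total b d * i}
     \<union> blocks b (width b d) (\<lambda>j. encode b d (xs ! j))"
| "encode b (Suc d) (Other ys) = blocks b (width b d) (\<lambda>j. encode b d (ys ! j))"
| "encode b (Suc d) Leaf = {}"

fun leaf_position :: "nat \<Rightarrow> nat \<Rightarrow> nat list \<Rightarrow> nat" where
  "leaf_position b (Suc d) (i # p) = (2 * b + i) * width b d + leaf_position b d p"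
| "leaf_position b _ _ = 0"

fun leaf_path :: "nat \<Rightarrow> nat \<Rightarrow> nat \<Rightarrow> nat list" where
  "leaf_path b 0 v = []"
| "leaf_path b (Suc d) v = (v div width b d - 2 * b) # leaf_path b d (v mod width b d)"

section \<open>Size and median of the encodings\<close>

lemma total_le: "total b d \<le> 2 * width b d"
  unfolding total_def width_def by (intro mult_left_mono power_mono) auto

lemma total_pos: "b > 0 \<Longrightarrow> total b d > 0"
  by (simp add: total_def)

lemma own_labels_SucE:
  assumes "x \<in> own_labels b (Suc d)"
  obtains i xs where "x = Own i xs" "i < b" "xs \<in> tuples b (other_labels b d)"
  using assms by auto

lemma other_labels_SucE:
  assumes "y \<in> other_labels b (Suc d)"
  obtains ys where "y = Other ys" "ys \<in> tuples b (own_labels b d)"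
  using assms by auto

lemma encode_subset:
  "x \<in> own_labels b d \<union> other_labels b d \<Longrightarrow> encode b d x \<subseteq> {..<width b d}"
proof (induction d arbitrary: x)
  case (Suc d)
  let ?w = "width b d"
  have block: "blocks b ?w (\<lambda>j. encode b d (zs ! j)) \<subseteq> {..<3 * b * ?w}"
    if "\<And>j. j < b \<Longrightarrow> zs ! j \<in> own_labels b d \<union> other_labels b d" for zs
    using blocks_bounds(2)[of b "\<lambda>j. encode b d (zs ! j)" ?w] Suc.IH[OF that] by blast
  have w: "width b (Suc d) = 5 * b * ?w"
    by (simp add: width_def)
  have pad: "total b d * k \<le> 2 * b * ?w" if "k \<le> b" for k
    using mult_le_mono[OF total_le[of b d] that] by (simp add: mult.commute mult.left_commute)
  from Suc.prems consider "x \<in> own_labels b (Suc d)" | "x \<in> other_labels b (Suc d)"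
    by blast
  then show ?case
  proof cases
    case 1
    then obtain i xs where x: "x = Own i xs" "i < b" "xs \<in> tuples b (other_labels b d)"
      by (rule own_labels_SucE)
    note xs = nth_tuples[OF x(3)]
    have "encode b (Suc d) x \<subseteq> {..<2 * b * ?w} \<union> {..<3 * b * ?w + 2 * b * ?w} \<union> {..<3 * b * ?w}"
      using block[of xs] x(1,2) xs pad[of "b - 1 - i"] pad[of i] by auto
    also have "\<dots> \<subseteq> {..<width b (Suc d)}"
      unfolding w by (auto simp: algebra_simps)
    finally show ?thesis .
  next
    case 2
    then obtain ys where y: "x = Other ys" "ys \<in> tuples b (own_labels b d)"
      by (rule other_labels_SucE)
    note ys = nth_tuples[OF y(2)]
    have "encode b (Suc d) x \<subseteq> {..<3 * b * ?w}"
      using block[of ys] y(1) ys by auto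
    also have "\<dots> \<subseteq> {..<width b (Suc d)}"
      unfolding w by auto
    finally show ?thesis .
  qed
qed (simp add: width_def)

lemma finite_encode: "x \<in> own_labels b d \<union> other_labels b d \<Longrightarrow> finite (encode b d x)"
  by (rule finite_subset[OF encode_subset]) auto

lemma card_encode_Own_filter:
  assumes "i < b" "\<And>j. j < b \<Longrightarrow> xs ! j \<in> other_labels b d"
    and "\<And>a. a < 2 * b * width b d \<Longrightarrow> p a"
  shows "card {a \<in> encode b (Suc d) (Own i xs). p a}
    = total b d * (b - 1 - i) + card {a \<in> blocks b (width b d) (\<lambda>j. encode b d (xs ! j)). p a}
      + card {a \<in> {3 * b * width b d..<3 * b * width b d + total b d * i}. p a}"
proof -
  let ?w = "width b d"
  let ?L = "{..<total b d * (b - 1 - i)}"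
  let ?B = "blocks b ?w (\<lambda>j. encode b d (xs ! j))"
  let ?R = "{3 * b * ?w..<3 * b * ?w + total b d * i}"
  have "total b d * (b - 1 - i) \<le> 2 * b * ?w"
    using mult_le_mono[OF total_le[of b d], of "b - 1 - i" b]
    by (simp add: mult.commute mult.left_commute)
  then have L: "?L \<subseteq> {..<2 * b * ?w}"
    by auto
  have B: "?B \<subseteq> {2 * b * ?w..<3 * b * ?w}"
    using blocks_bounds[of b "\<lambda>j. encode b d (xs ! j)" ?w] encode_subset assms(2) by fastforce
  have "{a \<in> encode b (Suc d) (Own i xs). p a} = (?L \<union> {a \<in> ?B. p a}) \<union> {a \<in> ?R. p a}"
    using L assms(3) by auto
  moreover have "(?L \<union> {a \<in> ?B. p a}) \<inter> {a \<in> ?R. p a} = {}"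
  proof -
    have "?L \<subseteq> {..<3 * b * ?w}"
      using L by (auto intro: less_le_trans)
    then show ?thesis
      using B by fastforce
  qed
  moreover have "?L \<inter> {a \<in> ?B. p a} = {}"
    using L B by fastforce
  moreover have "finite {a \<in> ?B. p a}"
    using B by (auto intro: finite_subset)
  ultimately show ?thesis
    by (simp add: card_Un_disjoint)
qed

text \<open>By induction each block holds \<open>total b d\<close> elements, and the padding has
  \<open>total b d * (b - 1)\<close> elements for every \<open>i\<close>. So the owner can pad
  without knowing the other input.\<close>

lemma card_encode:
  assumes "b > 0" "x \<in> own_labels b d" "y \<in> other_labels b d"
  shows "card (encode b d x) + card (encode b d y) = total b d"
  using assms(2,3)
proof (induction d arbitrary: x y)
  case (Suc d)
  obtain i xs where x: "x = Own i xs" "i < b" "xs \<in> tuples b (other_labels b d)"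
    using Suc.prems(1) by (rule own_labels_SucE)
  note xs = nth_tuples[OF x(3)]
  obtain ys where y: "y = Other ys" "ys \<in> tuples b (own_labels b d)"
    using Suc.prems(2) by (rule other_labels_SucE)
  note ys = nth_tuples[OF y(2)]
  have card_blocks: "card (blocks b (width b d) (\<lambda>j. encode b d (zs ! j))) = (\<Sum>j<b. card (encode b d (zs ! j)))"
    if "\<And>j. j < b \<Longrightarrow> zs ! j \<in> own_labels b d \<union> other_labels b d" for zs
    using card_blocks_filter[of b "\<lambda>j. encode b d (zs ! j)" "width b d" "\<lambda>_. True"]
      encode_subset[OF that] by simp
  have "card (encode b (Suc d) x) = total b d * (b - 1 - i)
      + card (blocks b (width b d) (\<lambda>j. encode b d (xs ! j)))
      + card {3 * b * width b d..<3 * b * width b d + total b d * i}"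
    unfolding x(1) using card_encode_Own_filter[OF x(2) xs, of "\<lambda>_. True"]
    by (simp only: simp_thms Collect_mem_eq)
  moreover have "card (encode b (Suc d) y) = card (blocks b (width b d) (\<lambda>j. encode b d (ys ! j)))"
    by (simp add: y(1))
  ultimately have "card (encode b (Suc d) x) + card (encode b (Suc d) y)
      = total b d * (b - 1 - i) + total b d * i
        + ((\<Sum>j<b. card (encode b d (ys ! j))) + (\<Sum>j<b. card (encode b d (xs ! j))))"
    using card_blocks[of xs] card_blocks[of ys] xs ys by simp
  also have "\<dots> = total b d * (b - 1 - i + i) + (\<Sum>j<b. total b d)"
    using Suc.IH xs ys by (simp add: distrib_left flip: sum.distrib)
  also have "\<dots> = total b d * (b - 1 - i + i + b)"
    by (simp add: algebra_simps)
  also have "b - 1 - i + i + b = 2 * b - 1"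
    using x(2) by simp
  finally show ?case
    by (simp add: total_def)
qed (simp add: total_def)

lemma leaf_position_less:
  assumes "b > 0" "x \<in> own_labels b d" "y \<in> other_labels b d"
  shows "leaf_position b d (jump d x y) < width b d"
  using assms(2,3)
proof (induction d arbitrary: x y)
  case (Suc d)
  obtain i xs where x: "x = Own i xs" "i < b" "xs \<in> tuples b (other_labels b d)"
    using Suc.prems(1) by (rule own_labels_SucE)
  note xs = nth_tuples[OF x(3)]
  obtain ys where y: "y = Other ys" "ys \<in> tuples b (own_labels b d)"
    using Suc.prems(2) by (rule other_labels_SucE)
  note ys = nth_tuples[OF y(2)]
  have "leaf_position b (Suc d) (jump (Suc d) x y) < (2 * b + i + 1) * width b d"
    using Suc.IH[OF ys xs] x(1,2) y(1) by simp
  also have "\<dots> \<le> (5 * b) * width b d"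
    using x(2) by (intro mult_right_mono) auto
  finally show ?case
    by (simp add: width_def)
qed (simp add: width_def)

lemma leaf_path_leaf_position:
  assumes "b > 0" "x \<in> own_labels b d" "y \<in> other_labels b d"
  shows "leaf_path b d (leaf_position b d (jump d x y)) = jump d x y"
  using assms(2,3)
proof (induction d arbitrary: x y)
  case (Suc d)
  obtain i xs where x: "x = Own i xs" "i < b" "xs \<in> tuples b (other_labels b d)"
    using Suc.prems(1) by (rule own_labels_SucE)
  note xs = nth_tuples[OF x(3)]
  obtain ys where y: "y = Other ys" "ys \<in> tuples b (own_labels b d)"
    using Suc.prems(2) by (rule other_labels_SucE)
  note ys = nth_tuples[OF y(2)]
  have "leaf_position b d (jump d (ys ! i) (xs ! i)) < width b d"
    using leaf_position_less[OF assms(1)] x(2) xs ys by blast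
  then show ?case
    using Suc.IH[OF ys xs] x(1,2) y(1) by simp
qed simp

text \<open>Below block \<open>i\<close> there are \<open>total b d * (b - 1)\<close> elements,
  \<open>b - 1 - i\<close> shares from the padding and \<open>i\<close> from earlier blocks, and
  equally many lie above it. So the median is that of block \<open>i\<close> alone. With
  \<open>Suc v\<close> in place of \<open>\<le> v\<close>, one count serves both
  inequalities.\<close>

lemma encode_rank:
  assumes "b > 0" "x \<in> own_labels b d" "y \<in> other_labels b d"
  defines "v \<equiv> leaf_position b d (jump d x y)"
  shows "card {a \<in> encode b d x. a < v} + card {a \<in> encode b d y. a < v} \<le> (total b d - 1) div 2"
    and "(total b d - 1) div 2
      < card {a \<in> encode b d x. a < Suc v} + card {a \<in> encode b d y. a < Suc v}"
proof -
  have "card {a \<in> encode b d x. a < v} + card {a \<in> encode b d y. a < v} \<le> (total b d - 1) div 2 \<and>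
      (total b d - 1) div 2
      < card {a \<in> encode b d x. a < Suc v} + card {a \<in> encode b d y. a < Suc v}"
    using assms(2,3) unfolding v_def
  proof (induction d arbitrary: x y)
    case 0
    then show ?case
      by (simp add: total_def Collect_conv_if)
  next
    case (Suc d)
    obtain i xs where x: "x = Own i xs" "i < b" "xs \<in> tuples b (other_labels b d)"
      using Suc.prems(1) by (rule own_labels_SucE)
    note xs = nth_tuples[OF x(3)]
    obtain ys where y: "y = Other ys" "ys \<in> tuples b (own_labels b d)"
      using Suc.prems(2) by (rule other_labels_SucE)
    note ys = nth_tuples[OF y(2)]
    let ?w = "width b d"
    define u where "u = leaf_position b d (jump d (ys ! i) (xs ! i))"
    have u: "u < ?w"
      unfolding u_def using leaf_position_less[OF assms(1)] x(2) xs ys by blast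
    \<comment> \<open>Needed for \<open>r = u\<close> and \<open>r = Suc u\<close>; the latter may
      equal the width.\<close>
    have below: "card {a \<in> encode b (Suc d) x. a < (2 * b + i) * ?w + r}
          + card {a \<in> encode b (Suc d) y. a < (2 * b + i) * ?w + r}
        = total b d * (b - 1)
          + (card {a \<in> encode b d (ys ! i). a < r} + card {a \<in> encode b d (xs ! i). a < r})"
      if r: "r \<le> ?w" for r
    proof -
      have sub: "encode b d (xs ! j) \<subseteq> {..<?w}" "encode b d (ys ! j) \<subseteq> {..<?w}" if "j < b" for j
        using encode_subset xs ys that by blast+
      have "(2 * b + i) * ?w + r \<le> (2 * b + i + 1) * ?w"
        using r by simp
      also have "\<dots> \<le> 3 * b * ?w"
        using x(2) by (intro mult_right_mono) auto
      finally have no_right: "{a \<in> {3 * b * ?w..<3 * b * ?w + total b d * i}. a < (2 * b + i) * ?w + r} = {}"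
        by auto
      have "card {a \<in> encode b (Suc d) x. a < (2 * b + i) * ?w + r}
          = total b d * (b - 1 - i)
            + ((\<Sum>j<i. card (encode b d (xs ! j))) + card {a \<in> encode b d (xs ! i). a < r})"
      proof -
        have "card {a \<in> encode b (Suc d) x. a < (2 * b + i) * ?w + r} = total b d * (b - 1 - i)
            + card {a \<in> blocks b ?w (\<lambda>j. encode b d (xs ! j)). a < (2 * b + i) * ?w + r}
            + card {a \<in> {3 * b * ?w..<3 * b * ?w + total b d * i}. a < (2 * b + i) * ?w + r}"
          unfolding x(1) by (rule card_encode_Own_filter[OF x(2) xs]) (simp_all add: algebra_simps)
        then show ?thesis
          unfolding no_right using card_blocks_below[OF sub(1) x(2) r] by simp
      qed
      moreover have "card {a \<in> encode b (Suc d) y. a < (2 * b + i) * ?w + r}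
          = (\<Sum>j<i. card (encode b d (ys ! j))) + card {a \<in> encode b d (ys ! i). a < r}"
        unfolding y(1) using card_blocks_below[OF sub(2) x(2) r] by simp
      moreover have "(\<Sum>j<i. card (encode b d (ys ! j))) + (\<Sum>j<i. card (encode b d (xs ! j)))
          = (\<Sum>j<i. total b d)"
        using x(2) xs ys by (simp add: card_encode[OF assms(1)] flip: sum.distrib)
      moreover have "total b d * (b - 1) = total b d * (b - 1 - i) + total b d * i"
        using x(2) by (simp flip: distrib_left)
      ultimately show ?thesis
        by (simp add: mult.commute)
    qed
    have "total b (Suc d) - 1 = 2 * (total b d * (b - 1)) + (total b d - 1)"
    proof -
      have "total b (Suc d) = total b d * (2 * b - 1)"
        by (simp add: total_def)
      also have "2 * b - 1 = 2 * (b - 1) + 1"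
        using assms(1) by simp
      finally show ?thesis
        using total_pos[OF assms(1), of d] by (simp add: algebra_simps)
    qed
    then have half: "(total b (Suc d) - 1) div 2 = total b d * (b - 1) + (total b d - 1) div 2"
      by simp
    have pos: "leaf_position b (Suc d) (jump (Suc d) x y) = (2 * b + i) * ?w + u"
      by (simp add: x(1) y(1) u_def)
    show ?case
      using Suc.IH[OF ys[OF x(2)] xs[OF x(2)]] below[of u] below[of "Suc u"] u
      unfolding pos half u_def[symmetric] by simp
  qed
  then show "card {a \<in> encode b d x. a < v} + card {a \<in> encode b d y. a < v} \<le> (total b d - 1) div 2"
    and "(total b d - 1) div 2
      < card {a \<in> encode b d x. a < Suc v} + card {a \<in> encode b d y. a < Suc v}"
    by simp_all
qed

text \<open>\<open>Suc\<close> shifts the elements into the universe \<open>{1..n}\<close> of the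
  problem.\<close>

lemma median_encode:
  assumes "b > 0" "x \<in> own_labels b d" "y \<in> other_labels b d"
  shows "median (Suc ` encode b d x) (Suc ` encode b d y) = Suc (leaf_position b d (jump d x y))"
proof (rule median_eqI)
  let ?v = "leaf_position b d (jump d x y)"
  have Suc_image: "{a \<in> Suc ` A. a < Suc v} = Suc ` {a \<in> A. a < v}"
    "{a \<in> Suc ` A. a \<le> Suc v} = Suc ` {a \<in> A. a < Suc v}" for A v
    by auto
  show "finite (Suc ` encode b d x)" "finite (Suc ` encode b d y)"
    using finite_encode assms(2,3) by blast+
  show "card {a \<in> Suc ` encode b d x. a < Suc ?v} + card {a \<in> Suc ` encode b d y. a < Suc ?v}
      \<le> (card (Suc ` encode b d x) + card (Suc ` encode b d y) - 1) div 2"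
    using encode_rank(1)[OF assms] by (simp add: Suc_image card_image card_encode[OF assms])
  show "(card (Suc ` encode b d x) + card (Suc ` encode b d y) - 1) div 2
      < card {a \<in> Suc ` encode b d x. a \<le> Suc ?v} + card {a \<in> Suc ` encode b d y. a \<le> Suc ?v}"
    using encode_rank(2)[OF assms] by (simp add: Suc_image card_image card_encode[OF assms])
qed

lemma finite_median_inputs: "finite (median_inputs n)"
  by (rule finite_subset[of _ "Pow {1..n} \<times> Pow {1..n}"]) (auto simp: median_inputs_def)

lemma encode_in_median_inputs:
  assumes "b > 0" "x \<in> own_labels b d" "y \<in> other_labels b d"
  shows "(Suc ` encode b d x, Suc ` encode b d y) \<in> median_inputs (width b d)"
proof -
  have "encode b d x \<union> encode b d y \<noteq> {}"
    using card_encode[OF assms] total_pos[OF assms(1), of d] by auto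
  moreover have "Suc ` encode b d z \<subseteq> {1..width b d}" if "z \<in> own_labels b d \<union> other_labels b d" for z
    using encode_subset[OF that] by auto
  ultimately show ?thesis
    using assms(2,3) by (auto simp: median_inputs_def)
qed

lemma median_protocol_solves_jump:
  assumes "b > 0" "computes_on P (median_inputs (width b d)) median"
  shows "solvable (steps P) (comm_cost P (median_inputs (width b d)))
    (own_labels b d) (other_labels b d) (jump d)"
proof -
  let ?e = "\<lambda>x. Suc ` encode b d x" and ?D = "median_inputs (width b d)"
  let ?X = "?e ` own_labels b d" and ?Y = "?e ` other_labels b d"
  have sub: "?X \<times> ?Y \<subseteq> ?D"
    using encode_in_median_inputs[OF assms(1)] by blast
  have "nonblanks (run P A B) \<le> comm_cost P ?D" if "A \<in> ?X" "B \<in> ?Y" for A B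
    unfolding comm_cost_def using sub that
    by (intro Max_ge finite_imageI finite_median_inputs) force
  moreover have "computes_on P (?X \<times> ?Y) median"
    using assms(2) sub unfolding computes_on_def by blast
  ultimately have "solvable (steps P) (comm_cost P ?D) ?X ?Y median"
    unfolding solvable_def by blast
  then show ?thesis
    by (rule solvable_transform[where \<phi> = ?e and \<psi> = ?e and g = "\<lambda>m. leaf_path b d (m - 1)"])
      (simp_all add: median_encode[OF assms(1)] leaf_path_leaf_position[OF assms(1)])
qed

section \<open>The lower bound for the median\<close>

lemma dense_in_self: "\<alpha> \<le> 1 \<Longrightarrow> dense_in \<alpha> S S"
  using mult_right_mono[of \<alpha> 1 "real (card S)"] by (simp add: dense_in_def)

theorem theorem1:
  fixes \<epsilon> :: real
  assumes "\<epsilon> > 0"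
  shows "\<not> admits_polytime_protocol median_inputs (\<lambda>n. median)
           (\<lambda>n. (log 2 (real n)) powr (1 - \<epsilon>))"
proof
  assume "admits_polytime_protocol median_inputs (\<lambda>n. median)
           (\<lambda>n. (log 2 (real n)) powr (1 - \<epsilon>))"
  then obtain P k where comp: "\<And>n. computes_on (P n) (median_inputs n) median"
    and "(\<lambda>n. real (steps (P n))) \<in> O(\<lambda>n. real n ^ k)"
    and "(\<lambda>n. real (comm_cost (P n) (median_inputs n))) \<in> O(\<lambda>n. (log 2 (real n)) powr (1 - \<epsilon>))"
    unfolding admits_polytime_protocol_def by blast
  then obtain C1 C2 where C: "C1 > 0" "C2 > 0"
    and ev: "\<forall>\<^sub>F n in sequentially. norm (real (steps (P n))) \<le> C1 * norm (real n ^ k)"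
      "\<forall>\<^sub>F n in sequentially. norm (real (comm_cost (P n) (median_inputs n)))
         \<le> C2 * norm ((log 2 (real n)) powr (1 - \<epsilon>))"
    by (elim landau_o.bigE)
  obtain N where N: "\<And>n. n \<ge> N \<Longrightarrow> real (steps (P n)) \<le> C1 * real n ^ k"
      "\<And>n. n \<ge> N \<Longrightarrow> real (comm_cost (P n) (median_inputs n)) \<le> C2 * log 2 (real n) powr (1 - \<epsilon>)"
    using eventually_conj[OF ev] by (auto simp: eventually_sequentially)
  \<comment> \<open>\<open>L D\<close> is \<open>log 2 n\<close> for
    \<open>n = (5 * D ^ 2) ^ D\<close>.\<close>
  define L :: "nat \<Rightarrow> real" where "L D = real D * log 2 (5 * real D ^ 2)" for D
  have "L \<in> o(\<lambda>D. real D ^ 2)"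
    unfolding L_def by real_asymp
  \<comment> \<open>Half of the exponent \<open>b / 48 = D ^ 2 / 48\<close> is reserved for
    \<open>k * log 2 n\<close>, the other half for the constant in \<open>ev3\<close>. The
    \<open>+ 1\<close> covers \<open>k = 0\<close>.\<close>
  then have ev1: "\<forall>\<^sub>F D in sequentially. norm (L D) \<le> 1 / (96 * (real k + 1)) * norm (real D ^ 2)"
    by (rule landau_o.smallD) simp
  \<comment> \<open>\<open>L D\<close> has order \<open>D * log D\<close>, so any \<epsilon> > 0
    brings its power below \<open>D\<close>. The factor \<open>1 / (6 * C2)\<close> bounds the cost
    by \<open>D / 6\<close>, strictly less than \<open>D / 3\<close>.\<close>
  have "(\<lambda>D. L D powr (1 - \<epsilon>)) \<in> o(\<lambda>D. real D)"
    unfolding L_def using assms by real_asymp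
  then have ev2: "\<forall>\<^sub>F D in sequentially. norm (L D powr (1 - \<epsilon>)) \<le> 1 / (6 * C2) * norm (real D)"
    by (rule landau_o.smallD) (use C in simp)
  have ev3: "\<forall>\<^sub>F D in sequentially. log 2 (16 * (C1 + 1)) < real D ^ 2 / 96"
    by real_asymp
  obtain D where D: "norm (L D) \<le> 1 / (96 * (real k + 1)) * norm (real D ^ 2)"
      "norm (L D powr (1 - \<epsilon>)) \<le> 1 / (6 * C2) * norm (real D)"
      "log 2 (16 * (C1 + 1)) < real D ^ 2 / 96" "D \<ge> max 1 N"
    using eventually_happens[OF eventually_conj[OF ev1 eventually_conj[OF ev2
          eventually_conj[OF ev3 eventually_ge_at_top[of "max 1 N"]]]]] by auto
  define b where "b = D ^ 2"
  define n where "n = width b D"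
  have b: "b > 0"
    using D(4) by (simp add: b_def)
  \<comment> \<open>Puts \<open>n\<close> beyond \<open>N\<close>, where the asymptotic bounds
    hold.\<close>
  have "D < 2 ^ D"
    by (rule less_exp)
  also have "\<dots> \<le> n"
    unfolding n_def width_def using b by (intro power_mono) auto
  finally have n: "n \<ge> N" "n > 0"
    using D(4) by simp_all
  have "real n = (5 * real D ^ 2) ^ D"
    by (simp add: n_def width_def b_def)
  moreover have "5 * real D ^ 2 > 0"
    using D(4) by simp
  ultimately have log_n: "log 2 (real n) = L D"
    by (simp only: log_nat_power L_def)
  \<comment> \<open>The maximum covers a protocol without steps; \<open>C1 + 1\<close> absorbs
    it.\<close>
  define T where "T = max 1 (steps (P n))"
  define c where "c = comm_cost (P n) (median_inputs n)"
  have "16 * real T < 2 powr (b / 48)"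
  proof -
    have "1 \<le> real n ^ k"
      using n by simp
    moreover have "0 \<le> C1 * real n ^ k"
      using C by simp
    ultimately have "real T \<le> (C1 + 1) * real n ^ k"
      using N(1)[OF n(1)] by (auto simp: T_def max_def algebra_simps)
    then have "16 * real T \<le> 16 * (C1 + 1) * real n ^ k"
      unfolding mult.assoc by (rule mult_left_mono) simp
    also have "\<dots> = 2 powr log 2 (16 * (C1 + 1) * real n ^ k)"
      using C n by simp
    also have "log 2 (16 * (C1 + 1) * real n ^ k) = log 2 (16 * (C1 + 1)) + real k * L D"
      using C n by (simp add: log_mult log_nat_power log_n del: distrib_left_numeral)
    also have "2 powr (log 2 (16 * (C1 + 1)) + real k * L D) < 2 powr (b / 48)"
    proof -
      have "real k * L D \<le> real k * (1 / (96 * (real k + 1)) * real D ^ 2)"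
        using D(1) by (intro mult_left_mono) auto
      also have "\<dots> = real k / (real k + 1) * (real D ^ 2 / 96)"
        by (simp add: field_simps)
      also have "\<dots> \<le> 1 * (real D ^ 2 / 96)"
        by (intro mult_right_mono) auto
      finally show ?thesis
        using D(3) by (simp add: b_def)
    qed
    finally show ?thesis .
  qed
  moreover have "3 * c < D"
  proof -
    have "real c \<le> C2 * (L D powr (1 - \<epsilon>))"
      using N(2)[OF n(1)] by (simp add: c_def log_n)
    also have "\<dots> \<le> C2 * (1 / (6 * C2) * real D)"
      using D(2) C by (intro mult_left_mono) auto
    also have "\<dots> = real D / 6"
      using C by simp
    finally show ?thesis
      using D(4) by linarith
  qed
  moreover have "solvable T c (own_labels b D) (other_labels b D) (jump D)"
    using median_protocol_solves_jump[OF b comp[of "width b D"]]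
    unfolding n_def[symmetric] c_def by (rule solvable_mono) (simp add: T_def)
  ultimately show False
    using pointer_jumping_lower_bound[of T b D "own_labels b D" "other_labels b D" c]
    by (simp add: dense_in_self T_def)
qed


end
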